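(* Let $m\ge 1$ be an integer. Then $$\sum_{n=0}^\infty|\Delta^m u(n)|^2\;\ge\;\frac{1}{2^{4m}}\prod_{i=0}^{2m-1}(8m-3-4i)\sum_{n=1}^\infty\frac{|u(n)|^2}{n^{4m}}$$ for every finitely supported $u:\mathbb{N}_0\to\mathbb{C}$ with $u(i)=0$ for all $0\le i\le 2m-1$, and $$\sum_{n=1}^\infty|D(\Delta^m u)(n)|^2\;\ge\;\frac{1}{2^{4m+2}}\prod_{i=0}^{2m}(8m+1-4i)\sum_{n=1}^\infty\frac{|u(n)|^2}{n^{4m+2}}$$ for every finitely supported $u:\mathbb{N}_0\to\mathbb{C}$ with $u(i)=0$ for all $0\le i\le 2m$.
   Context: $\mathbb{N}_0=\{0,1,2,\dots\}$. For $u:\mathbb{N}_0\to\mathbb{C}$: $Du(n):=u(n)-u(n-1)$ for $n\ge 1$; $\Delta u(n):=2u(n)-u(n-1)-u(n+1)$ for $n\ge 1$ and $\Delta u(0):=u(0)-u(1)$. $\Delta^m$ denotes the $m$-fold iterate of $\Delta$. *)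

theory Defs
  imports "HOL-Analysis.Analysis"
begin

text \<open>
  \<open>D u\<close> is meaningful only at indices \<open>n \<ge> 1\<close>. At \<open>n = 0\<close> the truncated
  subtraction gives the junk value \<open>0\<close>; sums involving \<open>D\<close> start at \<open>n = 1\<close>.
\<close>

definition diff_D :: "(nat \<Rightarrow> complex) \<Rightarrow> nat \<Rightarrow> complex" where
  "diff_D u n = u n - u (n - 1)"

definition laplacian :: "(nat \<Rightarrow> complex) \<Rightarrow> nat \<Rightarrow> complex" where
  "laplacian u n = (if n = 0 then u 0 - u 1 else 2 * u n - u (n - 1) - u (n + 1))"

definition finitely_supported :: "(nat \<Rightarrow> complex) \<Rightarrow> bool" where
  "finitely_supported u \<longleftrightarrow> finite {n. u n \<noteq> 0}"

end

theory Submission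
  imports Defs
begin

text \<open>
  Up to sign and a shift of the index, \<open>\<Delta>\<close> is \<open>D\<^sup>2\<close>; since \<open>u\<close> vanishes near the origin, the
  boundary condition in \<open>\<Delta>\<close> plays no role and the two left-hand sides are \<open>\<Sum> |D\<^sup>K u|\<^sup>2\<close> with
  \<open>K = 2 m\<close> and \<open>K = 2 m + 1\<close>.  They are bounded below by iterating the weighted Hardy inequality
  \<open>\<Sum> |D v(n)|\<^sup>2 / n\<^bsup>2k\<^esup> \<ge> (k + 1/4) \<Sum> |v(n)|\<^sup>2 / n\<^bsup>2k+2\<^esup>\<close>, valid when \<open>v\<close> vanishes on \<open>{0..k}\<close>.
  That inequality follows from \<open>|x - y|\<^sup>2 \<ge> a |x|\<^sup>2 - a / (1 - a) |y|\<^sup>2\<close> for \<open>0 < a < 1\<close>, applied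
  with \<open>a = 1 - sqrt (1 - 1/n)\<close> if \<open>k = 0\<close>, and with \<open>a = 3 / (2 n)\<close> if \<open>k \<ge> 1\<close>,
  except that \<open>a = 1\<close> at \<open>n = k + 1\<close>, where \<open>y = v(k) = 0\<close>.
\<close>

text \<open>For \<open>a = 1\<close> the junk value \<open>a / (1 - a) = 0\<close> is harmless because \<open>y = 0\<close>.\<close>

lemma cmod_diff_square_ge:
  fixes x y :: complex and a :: real
  assumes "0 < a" "a < 1 \<or> (a = 1 \<and> y = 0)"
  shows "(cmod (x - y))\<^sup>2 \<ge> a * (cmod x)\<^sup>2 - a / (1 - a) * (cmod y)\<^sup>2"
proof (cases "a = 1")
  case True
  then show ?thesis using assms by simp
next
  case False
  then have a: "0 < 1 - a" using assms by simp
  have "(cmod x - cmod y)\<^sup>2 - (a * (cmod x)\<^sup>2 - a / (1 - a) * (cmod y)\<^sup>2)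
      = ((1 - a) * cmod x - cmod y)\<^sup>2 / (1 - a)"
    using a by (simp add: field_simps power2_eq_square)
  also have "\<dots> \<ge> 0" using a by simp
  finally have "(cmod x - cmod y)\<^sup>2 \<ge> a * (cmod x)\<^sup>2 - a / (1 - a) * (cmod y)\<^sup>2" by simp
  moreover have "(cmod x - cmod y)\<^sup>2 \<le> (cmod (x - y))\<^sup>2"
    using norm_triangle_ineq3[of x y] by (simp flip: abs_le_square_iff)
  ultimately show ?thesis by linarith
qed

section \<open>Hardy inequalities from positive supersolutions\<close>

text \<open>Writing \<open>a n\<close> as \<open>1 - phi (n - 1) / phi n\<close> turns the condition
  on \<open>V\<close> into \<open>- D (w D phi) \<ge> V phi\<close>, read at \<open>n\<close> with
  outer forward difference: \<open>phi\<close> is a supersolution. Summing the two-point inequality,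
  \<open>v n\<close> gains \<open>w n * a n\<close> from term \<open>n\<close> and loses
  \<open>b n\<close> to term \<open>n + 1\<close>.\<close>

lemma hardy_from_supersolution:
  fixes v :: "nat \<Rightarrow> complex" and w a V :: "nat \<Rightarrow> real"
  assumes v: "\<And>i. i \<le> k \<Longrightarrow> v i = 0"
    and w: "\<And>n. n > k \<Longrightarrow> w n \<ge> 0"
    and a0: "\<And>n. n > k \<Longrightarrow> 0 < a n"
    and a1: "a (Suc k) \<le> 1" "\<And>n. n > Suc k \<Longrightarrow> a n < 1"
    and V: "\<And>n. n > k \<Longrightarrow> w n * a n - w (Suc n) * (a (Suc n) / (1 - a (Suc n))) \<ge> V n"
  shows "(\<Sum>n=1..N. (cmod (diff_D v n))\<^sup>2 * w n) \<ge> (\<Sum>n=1..N. V n * (cmod (v n))\<^sup>2)"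
proof -
  define b where "b n = w (Suc n) * (a (Suc n) / (1 - a (Suc n)))" for n
  have b: "b n \<ge> 0" if "n > k" for n
    unfolding b_def using w[of "Suc n"] a0[of "Suc n"] a1(2)[of "Suc n"] that by simp
  have step: "(cmod (diff_D v (Suc n)))\<^sup>2 * w (Suc n)
      \<ge> w (Suc n) * a (Suc n) * (cmod (v (Suc n)))\<^sup>2 - b n * (cmod (v n))\<^sup>2" for n
  proof (cases "Suc n > k")
    case False
    then show ?thesis using v by (simp add: diff_D_def)
  next
    case True
    have "(cmod (v (Suc n) - v n))\<^sup>2
        \<ge> a (Suc n) * (cmod (v (Suc n)))\<^sup>2 - a (Suc n) / (1 - a (Suc n)) * (cmod (v n))\<^sup>2"
    proof (rule cmod_diff_square_ge)
      show "0 < a (Suc n)" using a0 True by blast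
      show "a (Suc n) < 1 \<or> a (Suc n) = 1 \<and> v n = 0"
        using a1 v True by (cases "n = k") force+
    qed
    from mult_left_mono[OF this w[OF True]] show ?thesis
      by (simp add: diff_D_def b_def algebra_simps)
  qed
  \<comment> \<open>The boundary term is the reserve that the term \<open>N + 1\<close> consumes in
    the induction; it is nonnegative and dropped at the end.\<close>
  have "(\<Sum>n=1..N. (cmod (diff_D v n))\<^sup>2 * w n)
      \<ge> (\<Sum>n=1..N. V n * (cmod (v n))\<^sup>2) + b N * (cmod (v N))\<^sup>2"
  proof (induction N)
    case 0
    then show ?case using v[of 0] by simp
  next
    case (Suc N)
    have "(V (Suc N) + b (Suc N)) * (cmod (v (Suc N)))\<^sup>2
        \<le> w (Suc N) * a (Suc N) * (cmod (v (Suc N)))\<^sup>2"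
    proof (cases "Suc N > k")
      case True
      then show ?thesis using V[OF True] by (intro mult_right_mono) (auto simp: b_def)
    next
      case False
      then show ?thesis using v by simp
    qed
    then show ?case using Suc step[of N] by (simp add: algebra_simps)
  qed
  moreover have "b N * (cmod (v N))\<^sup>2 \<ge> 0"
    using b v by (cases "N > k") auto
  ultimately show ?thesis by linarith
qed

section \<open>Pointwise estimates for the weights\<close>

text \<open>This is \<open>phi n = sqrt n\<close>. With \<open>x = 1 / n\<close> the left side is
  \<open>2 - sqrt (1 - x) - sqrt (1 + x)\<close>, and squaring twice bounds it below by
  \<open>x^2 / 4\<close>.\<close>

lemma sqrt_hardy_weight:
  fixes n :: nat
  assumes "n > 0"
  defines "a \<equiv> \<lambda>n::nat. 1 - sqrt (1 - 1 / real n)"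
  shows "a n - a (Suc n) / (1 - a (Suc n)) \<ge> 1 / (4 * (real n)\<^sup>2)"
proof -
  define x where "x = 1 / real n"
  have x: "0 < x" "x \<le> 1" using assms by (auto simp: x_def)
  have "1 - 1 / real (Suc n) = 1 / (1 + x)"
    using assms(1) by (simp add: x_def field_simps)
  then have "a (Suc n) = 1 - 1 / sqrt (1 + x)"
    by (simp only: a_def real_sqrt_divide real_sqrt_one)
  moreover have "(1 - 1 / s) / (1 - (1 - 1 / s)) = s - 1" if "s > 0" for s :: real
    using that by (simp add: field_simps)
  ultimately have "a (Suc n) / (1 - a (Suc n)) = sqrt (1 + x) - 1"
    using x by simp
  moreover have "a n = 1 - sqrt (1 - x)" by (simp only: a_def x_def)
  ultimately have eq: "a n - a (Suc n) / (1 - a (Suc n)) = 2 - (sqrt (1 - x) + sqrt (1 + x))"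
    by simp
  have prod: "sqrt (1 - x) * sqrt (1 + x) \<le> 1 - x\<^sup>2 / 2"
  proof -
    have x2: "x\<^sup>2 \<le> 1" using x by (simp add: power_le_one)
    have "(1 - x) * (1 + x) = 1 - x\<^sup>2"
      by (simp add: algebra_simps power2_eq_square)
    then have "sqrt (1 - x) * sqrt (1 + x) = sqrt (1 - x\<^sup>2)"
      by (simp only: real_sqrt_mult[symmetric])
    also have "\<dots> \<le> sqrt ((1 - x\<^sup>2 / 2)\<^sup>2)"
      by (rule real_sqrt_le_mono) (simp add: power2_diff)
    also have "\<dots> = 1 - x\<^sup>2 / 2" using x2 by simp
    finally show ?thesis .
  qed
  have "(sqrt (1 - x) + sqrt (1 + x))\<^sup>2 = 2 + 2 * (sqrt (1 - x) * sqrt (1 + x))"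
    using x by (simp add: power2_sum)
  also have "\<dots> \<le> 4 - x\<^sup>2" using prod by simp
  also have "\<dots> \<le> (2 - x\<^sup>2 / 4)\<^sup>2" by (simp add: power2_diff)
  finally have "sqrt (1 - x) + sqrt (1 + x) \<le> 2 - x\<^sup>2 / 4"
  proof (rule power2_le_imp_le)
    have "x\<^sup>2 \<le> 1" using x by (simp add: power_le_one)
    then show "0 \<le> 2 - x\<^sup>2 / 4" by simp
  qed
  then show ?thesis unfolding eq by (simp add: x_def power_divide)
qed

text \<open>Bernoulli's inequality for \<open>(1 + 1/n)^(2k)\<close>; it makes the remaining
  condition on the weights rational in \<open>n\<close> and \<open>k\<close>.\<close>

lemma power_ratio_le:
  fixes n k :: nat
  assumes "n > 0"
  shows "(1 / real (Suc n)) ^ (2 * k) \<le> (1 / real n) ^ (2 * k) * (real n / (real n + 2 * real k))"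
proof -
  have "1 + 2 * real k / real n \<le> (1 + 1 / real n) ^ (2 * k)"
    using Bernoulli_inequality[of "1 / real n" "2 * k"]
    by (simp add: order_trans[of "-1" 0 "1 / real n"])
  also have "1 + 1 / real n = real (Suc n) / real n"
    using assms by (simp add: field_simps)
  also have "1 + 2 * real k / real n = (real n + 2 * real k) / real n"
    using assms by (simp add: field_simps)
  finally have "inverse ((real (Suc n) / real n) ^ (2 * k))
      \<le> inverse ((real n + 2 * real k) / real n)"
    using assms by (intro le_imp_inverse_le) simp_all
  then have "(real n / real (Suc n)) ^ (2 * k) \<le> real n / (real n + 2 * real k)"
    by (simp only: inverse_divide flip: power_inverse)
  then have "(1 / real n) ^ (2 * k) * (real n / real (Suc n)) ^ (2 * k)
      \<le> (1 / real n) ^ (2 * k) * (real n / (real n + 2 * real k))"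
    by (intro mult_left_mono) simp_all
  moreover have "(1 / real n) ^ (2 * k) * (real n / real (Suc n)) ^ (2 * k)
      = (1 / real (Suc n)) ^ (2 * k)"
    using assms by (simp del: of_nat_Suc flip: power_mult_distrib)
  ultimately show ?thesis by simp
qed

lemma hardy_weight_tail:
  fixes n k :: real
  assumes "k \<ge> 1" "n \<ge> k + 2"
  shows "3 / (2 * n) - n / (n + 2 * k) * (3 / (2 * n - 1)) \<ge> (k + 1/4) / n\<^sup>2"
proof -
  \<comment> \<open>In the nonnegative variables \<open>d\<close> and \<open>e\<close> the cleared
    numerator has only positive coefficients.\<close>
  define d where "d = n - k - 2"
  define e where "e = k - 1"
  have de: "d \<ge> 0" "e \<ge> 0" "k = e + 1" "n = d + e + 3" using assms by (auto simp: d_def e_def)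
  have pos: "n > 0" "n + 2 * k > 0" "2 * n - 1 > 0" using assms by auto
  have "3 * n * ((n + 2 * k) * (2 * n - 1) - 2 * n\<^sup>2)
      - 2 * (k + 1/4) * ((n + 2 * k) * (2 * n - 1))
      = (8 * e + 4) * d\<^sup>2 + (8 * e\<^sup>2 + 34 * e + 21/2) * d + (10 * e\<^sup>2 + 51/2 * e + 1/2)"
    unfolding de(3,4) by (simp add: algebra_simps power2_eq_square)
  also have "\<dots> \<ge> 0" using de(1,2) by simp
  finally have "3 * n * ((n + 2 * k) * (2 * n - 1) - 2 * n\<^sup>2)
      - 2 * (k + 1/4) * ((n + 2 * k) * (2 * n - 1)) \<ge> 0" .
  moreover have "3 / (2 * n) - n / (n + 2 * k) * (3 / (2 * n - 1)) - (k + 1/4) / n\<^sup>2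
     = (3 * n * ((n + 2 * k) * (2 * n - 1) - 2 * n\<^sup>2)
      - 2 * (k + 1/4) * ((n + 2 * k) * (2 * n - 1))) / (2 * n\<^sup>2 * ((n + 2 * k) * (2 * n - 1)))"
    using pos by (simp add: divide_simps) (simp add: algebra_simps power2_eq_square)
  ultimately show ?thesis using pos
    by (smt (verit) divide_nonneg_pos mult_pos_pos zero_less_power)
qed

text \<open>The value \<open>1 / 2\<close> separates the two sides.\<close>

lemma hardy_weight_first:
  fixes k :: real
  assumes "k \<ge> 1"
  shows "1 - (k + 1) / (k + 1 + 2 * k) * (3 / (2 * (k + 1) - 1)) \<ge> (k + 1/4) / (k + 1)\<^sup>2"
proof -
  have "(k + 1) / (k + 1 + 2 * k) \<le> 1 / 2" "3 / (2 * (k + 1) - 1) \<le> 1"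
    using assms by (auto simp: field_simps)
  then have "(k + 1) / (k + 1 + 2 * k) * (3 / (2 * (k + 1) - 1)) \<le> 1 / 2 * 1"
    using assms by (intro mult_mono) auto
  moreover have "(k + 1/4) / (k + 1)\<^sup>2 \<le> 1 / 2"
  proof -
    have "k + 1/4 \<le> 1 / 2 * (k + 1)\<^sup>2" by (simp add: power2_sum)
    then show ?thesis using assms by (subst pos_divide_le_eq) auto
  qed
  ultimately show ?thesis by linarith
qed

section \<open>The one-step weighted Hardy inequality\<close>

lemma weighted_hardy:
  fixes v :: "nat \<Rightarrow> complex"
  assumes v: "\<And>i. i \<le> k \<Longrightarrow> v i = 0"
  shows "(\<Sum>n=1..N. (cmod (diff_D v n))\<^sup>2 / real n ^ (2 * k))
    \<ge> (real k + 1/4) * (\<Sum>n=1..N. (cmod (v n))\<^sup>2 / real n ^ (2 * Suc k))"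
proof -
  define V where "V n = (real k + 1/4) / (real n)\<^sup>2 * (1 / real n) ^ (2 * k)" for n
  have "(\<Sum>n=1..N. (cmod (diff_D v n))\<^sup>2 * (1 / real n) ^ (2 * k))
      \<ge> (\<Sum>n=1..N. V n * (cmod (v n))\<^sup>2)"
  proof (cases "k = 0")
    case True
    show ?thesis
    proof (rule hardy_from_supersolution[where k = k and a = "\<lambda>n. 1 - sqrt (1 - 1 / real n)"])
      fix n :: nat
      assume "n > k"
      then show "V n \<le> (1 / real n) ^ (2 * k) * (1 - sqrt (1 - 1 / real n))
          - (1 / real (Suc n)) ^ (2 * k) * ((1 - sqrt (1 - 1 / real (Suc n)))
              / (1 - (1 - sqrt (1 - 1 / real (Suc n)))))"
        using sqrt_hardy_weight[of n] True unfolding V_def by simp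
    qed (use v True in auto)
  next
    case False
    \<comment> \<open>The model is \<open>phi n = n^(3/2)\<close>, with leading coefficient
      \<open>3 k - 3/4\<close> in place of \<open>k + 1/4\<close>: enough slack for
      \<open>k \<ge> 1\<close>, but negative for \<open>k = 0\<close>. At \<open>n = k + 1\<close>
      the value \<open>3 / (2 n)\<close> can be too small: for \<open>k = 1\<close> it gives
      \<open>1/4\<close> after Bernoulli, below \<open>5/16\<close>.\<close>
    define a where "a n = (if n = Suc k then 1 else 3 / (2 * real n))" for n
    have k: "real k \<ge> 1" using False by simp
    show ?thesis
    proof (rule hardy_from_supersolution[where k = k and a = a])
      fix n :: nat
      assume n: "n > k"
      \<comment> \<open>Since \<open>Suc n > Suc k\<close>, the exceptional value of
        \<open>a\<close> does not occur here.\<close>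
      have quot: "a (Suc n) / (1 - a (Suc n)) = 3 / (2 * real n - 1)"
      proof -
        have "2 * real n - 1 > 0" using n by simp
        then show ?thesis using n by (simp add: a_def divide_simps)
      qed
      have "(1 / real (Suc n)) ^ (2 * k) * (3 / (2 * real n - 1))
          \<le> (1 / real n) ^ (2 * k) * (real n / (real n + 2 * real k)) * (3 / (2 * real n - 1))"
        using n k by (intro mult_right_mono power_ratio_le) auto
      moreover have "a n - real n / (real n + 2 * real k) * (3 / (2 * real n - 1))
          \<ge> (real k + 1/4) / (real n)\<^sup>2"
      proof (cases "n = Suc k")
        case True
        then show ?thesis using hardy_weight_first[OF k] by (simp add: a_def algebra_simps)
      next
        case False
        then show ?thesis using hardy_weight_tail[OF k, of n] n by (simp add: a_def)
      qed
      then have "(1 / real n) ^ (2 * k) * (a n - real n / (real n + 2 * real k) * (3 / (2 * real n - 1)))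
          \<ge> (1 / real n) ^ (2 * k) * ((real k + 1/4) / (real n)\<^sup>2)"
        by (intro mult_left_mono) auto
      ultimately show "V n \<le> (1 / real n) ^ (2 * k) * a n
          - (1 / real (Suc n)) ^ (2 * k) * (a (Suc n) / (1 - a (Suc n)))"
        unfolding quot V_def by (simp only: right_diff_distrib mult_ac)
    qed (use v False in \<open>auto simp: a_def\<close>)
  qed
  then show ?thesis
    by (simp add: V_def sum_distrib_left power_one_over power2_eq_square mult.assoc)
qed

section \<open>Iterating the inequality\<close>

lemma diff_D_funpow_eq_0:
  assumes "\<And>i. i < K \<Longrightarrow> u i = 0" "i < K"
  shows "(diff_D ^^ j) u i = 0"
  using assms(2) by (induction j arbitrary: i) (auto simp: diff_D_def assms(1))

lemma diff_D_funpow_support: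
  assumes "\<And>i. i \<ge> B \<Longrightarrow> u i = 0" "i \<ge> B + j"
  shows "(diff_D ^^ j) u i = 0"
  using assms(2) by (induction j arbitrary: i) (auto simp: diff_D_def assms(1))

text \<open>Each step strips one difference and costs the factor \<open>j + 1/4\<close>. Differences
  look only backwards, so all iterates still vanish below \<open>K\<close>, which covers
  \<open>{0..j}\<close> as long as \<open>j < K\<close>.\<close>

lemma iterated_hardy:
  fixes u :: "nat \<Rightarrow> complex"
  assumes u: "\<And>i. i < K \<Longrightarrow> u i = 0" and "j \<le> K"
  shows "(\<Sum>n=1..N. (cmod ((diff_D ^^ K) u n))\<^sup>2)
    \<ge> (\<Prod>k<j. real k + 1/4) * (\<Sum>n=1..N. (cmod ((diff_D ^^ (K - j)) u n))\<^sup>2 / real n ^ (2 * j))"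
  using \<open>j \<le> K\<close>
proof (induction j)
  case 0
  then show ?case by simp
next
  case (Suc j)
  have "(diff_D ^^ (K - j)) u = diff_D ((diff_D ^^ (K - Suc j)) u)"
    using Suc.prems by (simp add: Suc_diff_Suc flip: funpow.simps(2) comp_apply[of diff_D])
  moreover have "(diff_D ^^ (K - Suc j)) u i = 0" if "i \<le> j" for i
    using diff_D_funpow_eq_0[of K u i] u that Suc.prems by simp
  ultimately have "(\<Sum>n=1..N. (cmod ((diff_D ^^ (K - j)) u n))\<^sup>2 / real n ^ (2 * j))
    \<ge> (real j + 1/4) * (\<Sum>n=1..N. (cmod ((diff_D ^^ (K - Suc j)) u n))\<^sup>2 / real n ^ (2 * Suc j))"
    using weighted_hardy[of j "(diff_D ^^ (K - Suc j)) u" N] by simp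
  then have "(\<Prod>k<j. real k + 1/4) * (\<Sum>n=1..N. (cmod ((diff_D ^^ (K - j)) u n))\<^sup>2 / real n ^ (2 * j))
    \<ge> (\<Prod>k<j. real k + 1/4) * ((real j + 1/4) * (\<Sum>n=1..N. (cmod ((diff_D ^^ (K - Suc j)) u n))\<^sup>2 / real n ^ (2 * Suc j)))"
    by (intro mult_left_mono prod_nonneg) auto
  then show ?case using Suc by (simp add: mult.assoc)
qed

text \<open>Reversing the product matches \<open>(4 K - 3 - 4 i) / 4\<close> with
  \<open>k + 1/4\<close> at \<open>k = K - 1 - i\<close>.\<close>

lemma hardy_constant:
  "1 / 2 ^ (2 * K) * (\<Prod>i<K. 4 * real K - 3 - 4 * real i) = (\<Prod>k<K. real k + 1/4)"
proof -
  have "(\<Prod>k<K. real k + 1/4) = (\<Prod>i<K. real (K - Suc i) + 1/4)"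
    by (rule prod.nat_diff_reindex[symmetric])
  also have "\<dots> = (\<Prod>i<K. (4 * real K - 3 - 4 * real i) / 4)"
    by (rule prod.cong) (auto simp: of_nat_diff)
  also have "\<dots> = 1 / 2 ^ (2 * K) * (\<Prod>i<K. 4 * real K - 3 - 4 * real i)"
    by (simp add: prod_dividef power_mult)
  finally show ?thesis by simp
qed

lemma infsum_eq_sum_support:
  fixes f :: "nat \<Rightarrow> real"
  assumes "F \<subseteq> A" "finite F" "\<And>n. n \<in> A - F \<Longrightarrow> f n = 0"
  shows "infsum f A = sum f F"
proof -
  have "infsum f A = infsum f F"
    using assms by (intro infsum_cong_neutral) auto
  then show ?thesis using assms(2) by simp
qed

lemma higher_order_hardy:
  fixes u :: "nat \<Rightarrow> complex"
  assumes u: "\<And>i. i < K \<Longrightarrow> u i = 0" and fin: "finitely_supported u"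
  shows "(\<Sum>\<^sub>\<infinity>n\<in>{1..}. (cmod ((diff_D ^^ K) u n))\<^sup>2)
    \<ge> 1 / 2 ^ (2 * K) * (\<Prod>i<K. 4 * real K - 3 - 4 * real i)
       * (\<Sum>\<^sub>\<infinity>n\<in>{1..}. (cmod (u n))\<^sup>2 / real n ^ (2 * K))"
proof -
  obtain B where "\<And>i. u i \<noteq> 0 \<Longrightarrow> i < B"
    using fin unfolding finitely_supported_def finite_nat_set_iff_bounded by auto
  then have B: "u i = 0" if "i \<ge> B" for i using that by (meson linorder_not_le)
  \<comment> \<open>Each difference extends the support by at most one, so \<open>B + K\<close>
    bounds the supports of \<open>u\<close> and of its \<open>K\<close>-th difference.\<close>
  have "(\<Sum>\<^sub>\<infinity>n\<in>{1..}. (cmod ((diff_D ^^ K) u n))\<^sup>2) = (\<Sum>n=1..B+K. (cmod ((diff_D ^^ K) u n))\<^sup>2)"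
    by (rule infsum_eq_sum_support) (auto intro: diff_D_funpow_support[OF B])
  moreover have "(\<Sum>\<^sub>\<infinity>n\<in>{1..}. (cmod (u n))\<^sup>2 / real n ^ (2 * K))
      = (\<Sum>n=1..B+K. (cmod (u n))\<^sup>2 / real n ^ (2 * K))"
    by (rule infsum_eq_sum_support) (auto intro: B)
  ultimately show ?thesis
    unfolding hardy_constant using iterated_hardy[of K u K "B + K"] u by simp
qed

section \<open>From Laplacians to iterated differences\<close>

text \<open>The hypothesis makes the boundary formula at \<open>n = 0\<close> agree with the second
  difference. For \<open>j = 0\<close> it is trivial, and the junk value
  \<open>diff_D w 0 = 0\<close> gives the same agreement.\<close>

lemma laplacian_shift:
  assumes "w (j - 1) = w j"
  shows "laplacian (\<lambda>n. c * w (n + j)) n = - c * diff_D (diff_D w) (n + Suc j)"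
  using assms by (cases n) (auto simp: laplacian_def diff_D_def algebra_simps)

lemma laplacian_funpow_eq:
  fixes u :: "nat \<Rightarrow> complex"
  assumes u: "\<And>i. i < m \<Longrightarrow> u i = 0" and "j \<le> m"
  shows "(laplacian ^^ j) u n = (-1) ^ j * (diff_D ^^ (2 * j)) u (n + j)"
  using \<open>j \<le> m\<close>
proof (induction j arbitrary: n)
  case 0
  then show ?case by simp
next
  case (Suc j)
  have "(diff_D ^^ (2 * j)) u i = 0" if "i \<le> j" for i
    using diff_D_funpow_eq_0[of m u i] u that Suc.prems by simp
  then have "(diff_D ^^ (2 * j)) u (j - 1) = (diff_D ^^ (2 * j)) u j" by simp
  note shift = laplacian_shift[OF this, of "(-1) ^ j" n]
  have "(laplacian ^^ j) u = (\<lambda>n. (-1) ^ j * (diff_D ^^ (2 * j)) u (n + j))"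
    using Suc by auto
  then show ?case using shift by simp
qed

text \<open>The shifted sum starts at \<open>a + m\<close> instead of \<open>1\<close>; the terms in
  between vanish.\<close>

lemma infsum_shift_vanishing:
  fixes f :: "nat \<Rightarrow> real"
  assumes "\<And>n. n < b + m \<Longrightarrow> f n = 0" "a \<le> b" "a + m \<ge> 1"
  shows "(\<Sum>\<^sub>\<infinity>n\<in>{a..}. f (n + m)) = (\<Sum>\<^sub>\<infinity>n\<in>{1..}. f n)"
proof -
  have "(\<Sum>\<^sub>\<infinity>n\<in>{a..}. f (n + m)) = infsum f ((\<lambda>n. n + m) ` {a..})"
    by (subst infsum_reindex) (auto simp: o_def)
  also have "(\<lambda>n. n + m) ` {a..} = {a + m..}"
    by (auto simp: image_iff le_iff_add)
  also have "infsum f {a + m..} = infsum f {1..}"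
    using assms by (intro infsum_cong_neutral) auto
  finally show ?thesis .
qed

theorem theorem2p3:
  fixes m :: nat
  assumes "m \<ge> 1"
  shows "(\<forall>u :: nat \<Rightarrow> complex. finitely_supported u \<longrightarrow> (\<forall>i \<le> 2 * m - 1. u i = 0) \<longrightarrow>
            (\<Sum>\<^sub>\<infinity>n. (cmod ((laplacian ^^ m) u n))\<^sup>2)
              \<ge> 1 / 2 ^ (4 * m) * (\<Prod>i = 0..2 * m - 1. 8 * real m - 3 - 4 * real i)
                 * (\<Sum>\<^sub>\<infinity>n\<in>{1..}. (cmod (u n))\<^sup>2 / real n ^ (4 * m)))
       \<and> (\<forall>u :: nat \<Rightarrow> complex. finitely_supported u \<longrightarrow> (\<forall>i \<le> 2 * m. u i = 0) \<longrightarrow>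
            (\<Sum>\<^sub>\<infinity>n\<in>{1..}. (cmod (diff_D ((laplacian ^^ m) u) n))\<^sup>2)
              \<ge> 1 / 2 ^ (4 * m + 2) * (\<Prod>i = 0..2 * m. 8 * real m + 1 - 4 * real i)
                 * (\<Sum>\<^sub>\<infinity>n\<in>{1..}. (cmod (u n))\<^sup>2 / real n ^ (4 * m + 2)))"
proof (intro conjI allI impI)
  fix u :: "nat \<Rightarrow> complex"
  assume fin: "finitely_supported u" and "\<forall>i \<le> 2 * m - 1. u i = 0"
  then have u: "u i = 0" if "i < 2 * m" for i using that by simp
  have "(\<Sum>\<^sub>\<infinity>n. (cmod ((laplacian ^^ m) u n))\<^sup>2)
      = (\<Sum>\<^sub>\<infinity>n\<in>{0..}. (cmod ((diff_D ^^ (2 * m)) u (n + m)))\<^sup>2)"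
    using laplacian_funpow_eq[of m u m] u by (simp add: norm_mult norm_power)
  also have "\<dots> = (\<Sum>\<^sub>\<infinity>n\<in>{1..}. (cmod ((diff_D ^^ (2 * m)) u n))\<^sup>2)"
    using diff_D_funpow_eq_0[of "2 * m" u] u assms
    by (intro infsum_shift_vanishing[where b = m]) auto
  finally have eq: "(\<Sum>\<^sub>\<infinity>n. (cmod ((laplacian ^^ m) u n))\<^sup>2)
      = (\<Sum>\<^sub>\<infinity>n\<in>{1..}. (cmod ((diff_D ^^ (2 * m)) u n))\<^sup>2)" .
  have "{0..2 * m - 1} = {..<2 * m}" using assms by auto
  then show "(\<Sum>\<^sub>\<infinity>n. (cmod ((laplacian ^^ m) u n))\<^sup>2)
      \<ge> 1 / 2 ^ (4 * m) * (\<Prod>i = 0..2 * m - 1. 8 * real m - 3 - 4 * real i)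
         * (\<Sum>\<^sub>\<infinity>n\<in>{1..}. (cmod (u n))\<^sup>2 / real n ^ (4 * m))"
    unfolding eq using higher_order_hardy[of "2 * m" u] u fin by simp
next
  fix u :: "nat \<Rightarrow> complex"
  assume fin: "finitely_supported u" and "\<forall>i \<le> 2 * m. u i = 0"
  then have u: "u i = 0" if "i < 2 * m + 1" for i using that by simp
  have "cmod (diff_D ((laplacian ^^ m) u) n) = cmod ((diff_D ^^ (2 * m + 1)) u (n + m))"
    if "n \<in> {1..}" for n
  proof -
    have "diff_D ((laplacian ^^ m) u) n = (-1) ^ m * (diff_D ^^ (2 * m + 1)) u (n + m)"
      \<comment> \<open>As \<open>n \<ge> 1\<close>, shifting by \<open>m\<close> commutes with the
        truncated \<open>n - 1\<close>.\<close>
      using laplacian_funpow_eq[of m u m] u that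
      by (cases n) (simp_all add: diff_D_def right_diff_distrib)
    then show ?thesis by (simp add: norm_mult norm_power)
  qed
  then have "(\<Sum>\<^sub>\<infinity>n\<in>{1..}. (cmod (diff_D ((laplacian ^^ m) u) n))\<^sup>2)
      = (\<Sum>\<^sub>\<infinity>n\<in>{1..}. (cmod ((diff_D ^^ (2 * m + 1)) u (n + m)))\<^sup>2)"
    by (intro infsum_cong) simp
  also have "\<dots> = (\<Sum>\<^sub>\<infinity>n\<in>{1..}. (cmod ((diff_D ^^ (2 * m + 1)) u n))\<^sup>2)"
    using diff_D_funpow_eq_0[of "2 * m + 1" u _ "2 * m + 1"] u assms
    by (intro infsum_shift_vanishing[where b = "m + 1"]) auto
  finally have eq: "(\<Sum>\<^sub>\<infinity>n\<in>{1..}. (cmod (diff_D ((laplacian ^^ m) u) n))\<^sup>2)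
      = (\<Sum>\<^sub>\<infinity>n\<in>{1..}. (cmod ((diff_D ^^ (2 * m + 1)) u n))\<^sup>2)" .
  \<comment> \<open>These identities rewrite the bound for \<open>K = 2 m + 1\<close> into the
    stated form.\<close>
  have "{0..2 * m} = {..<2 * m + 1}" by auto
  moreover have "4 * real (2 * m + 1) - 3 = 8 * real m + 1" by simp
  moreover have "2 * (2 * m + 1) = 4 * m + 2" by simp
  moreover note higher_order_hardy[of "2 * m + 1" u, OF u fin]
  ultimately show "(\<Sum>\<^sub>\<infinity>n\<in>{1..}. (cmod (diff_D ((laplacian ^^ m) u) n))\<^sup>2)
      \<ge> 1 / 2 ^ (4 * m + 2) * (\<Prod>i = 0..2 * m. 8 * real m + 1 - 4 * real i)
         * (\<Sum>\<^sub>\<infinity>n\<in>{1..}. (cmod (u n))\<^sup>2 / real n ^ (4 * m + 2))"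
    unfolding eq by (simp only:)
qed

end
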